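(* Let $\mathbf{a}\in\mathbb{R}^{n_{\mathrm e}}_{\ge 0}$, $\omega>0$, $\mathbf{f}_{\mathrm A}\in\mathbb{R}^{n_{\mathrm{dof}}}$ and $\overline{p}>0$. The following statements are equivalent: (1) $\mathbf{K}(\mathbf{a})-\omega^2\mathbf{M}(\mathbf{a})\succeq \mathbf{0}$, $\ \mathbf{f}_{\mathrm A}\in\mathcal{R}\big(\mathbf{K}(\mathbf{a})-\omega^2\mathbf{M}(\mathbf{a})\big)$, and $\ \tfrac12\,\omega\,\mathbf{f}_{\mathrm A}^{\mathsf T}\big[\mathbf{K}(\mathbf{a})-\omega^2\mathbf{M}(\mathbf{a})\big]^{\dagger}\mathbf{f}_{\mathrm A}\le\overline{p}$; (2) $\begin{pmatrix}\frac{2\overline{p}}{\omega} & -\mathbf{f}_{\mathrm A}^{\mathsf T}\\ -\mathbf{f}_{\mathrm A} & \mathbf{K}(\mathbf{a})-\omega^2\mathbf{M}(\mathbf{a})\end{pmatrix}\succeq \mathbf{0}$.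
   Context: For $\mathbf{a}\in\mathbb{R}^{n_{\mathrm e}}_{\ge 0}$ the stiffness and mass matrices are $\mathbf{K}(\mathbf{a})=\sum_{e=1}^{n_{\mathrm e}}\big[a_e\mathbf{K}^{(1)}_e+a_e^2\mathbf{K}^{(2)}_e+a_e^3\mathbf{K}^{(3)}_e\big]$ and $\mathbf{M}(\mathbf{a})=\mathbf{M}^{(0)}+\sum_{e=1}^{n_{\mathrm e}}a_e\mathbf{M}^{(1)}_e$, where all $\mathbf{K}^{(i)}_e$, $\mathbf{M}^{(0)}$, $\mathbf{M}^{(1)}_e$ are fixed real symmetric positive semidefinite $n_{\mathrm{dof}}\times n_{\mathrm{dof}}$ matrices. $\mathbf{A}\succeq\mathbf{0}$ means that the real symmetric matrix $\mathbf{A}$ is positive semidefinite, $\mathcal{R}(\cdot)$ is the range (column space), and $(\cdot)^{\dagger}$ is the Moore-Penrose pseudoinverse. *)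

theory Defs
  imports "HOL-Analysis.Analysis"
begin

definition psd :: "real^'n^'n \<Rightarrow> bool" where
  "psd A \<longleftrightarrow> transpose A = A \<and> (\<forall>x. 0 \<le> x \<bullet> (A *v x))"

text \<open>The four Penrose equations; over the reals the conjugate transpose is the transpose.\<close>

definition is_pseudoinverse :: "real^'n^'m \<Rightarrow> real^'m^'n \<Rightarrow> bool" where
  "is_pseudoinverse A X \<longleftrightarrow>
     A ** X ** A = A \<and> X ** A ** X = X \<and>
     transpose (A ** X) = A ** X \<and> transpose (X ** A) = X ** A"

definition pseudoinverse :: "real^'n^'m \<Rightarrow> real^'m^'n" where
  "pseudoinverse A = (THE X. is_pseudoinverse A X)"

text \<open>The block matrix with rows \<open>(A, B)\<close> and \<open>(C, D)\<close>; \<open>Inl\<close> indexes the first block row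
  and column, \<open>Inr\<close> the second.\<close>

definition block_matrix ::
  "'a^'n^'m \<Rightarrow> 'a^'k^'m \<Rightarrow> 'a^'n^'l \<Rightarrow> 'a^'k^'l \<Rightarrow> 'a^('n + 'k)^('m + 'l)" where
  "block_matrix A B C D =
     (\<chi> i j. case i of
        Inl i' \<Rightarrow> (case j of Inl j' \<Rightarrow> A $ i' $ j' | Inr j' \<Rightarrow> B $ i' $ j')
      | Inr i' \<Rightarrow> (case j of Inl j' \<Rightarrow> C $ i' $ j' | Inr j' \<Rightarrow> D $ i' $ j'))"

definition stiffness ::
  "('e::finite \<Rightarrow> real^'n^'n) \<Rightarrow> ('e \<Rightarrow> real^'n^'n) \<Rightarrow> ('e \<Rightarrow> real^'n^'n) \<Rightarrow>
     real^'e \<Rightarrow> real^'n^'n" where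
  "stiffness K1 K2 K3 a =
     (\<Sum>e\<in>UNIV. (a $ e) *\<^sub>R K1 e + (a $ e)\<^sup>2 *\<^sub>R K2 e + (a $ e) ^ 3 *\<^sub>R K3 e)"

definition mass ::
  "real^'n^'n \<Rightarrow> ('e::finite \<Rightarrow> real^'n^'n) \<Rightarrow> real^'e \<Rightarrow> real^'n^'n" where
  "mass M0 M1 a = M0 + (\<Sum>e\<in>UNIV. (a $ e) *\<^sub>R M1 e)"

end

theory Submission
  imports Defs
begin

text \<open>
  The matrices \<open>K(a)\<close> and \<open>M(a)\<close> enter only through the single matrix
  \<open>A = K(a) - \<omega>\<^sup>2 M(a)\<close>, and the equivalence is the generalised Schur complement criterion for the
  bordered matrix with corner \<open>c = 2 p / \<omega>\<close>, border \<open>- f\<close> and block \<open>A\<close>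
  (\<open>psd_bordered_iff\<close>). The quadratic form of that matrix at \<open>(t, v)\<close> is
  \<open>c t\<^sup>2 - 2 t (f \<bullet> v) + v \<bullet> A v\<close>. Positive semidefiniteness of the bordered matrix
  includes symmetry of \<open>A\<close> and, at \<open>t = 0\<close>, nonnegativity of its form, so \<open>A\<close> is positive
  semidefinite on both sides of the equivalence. If \<open>f = A w\<close>, completing the square turns it into
  \<open>(v - t w) \<bullet> A (v - t w) + t\<^sup>2 (c - w \<bullet> A w)\<close>, and \<open>w \<bullet> A w = f \<bullet> A\<^sup>\<dagger> f\<close> by the first
  Penrose equation; so the form is nonnegative exactly when \<open>f \<bullet> A\<^sup>\<dagger> f \<le> c\<close>, the critical
  vectors being \<open>v = t w\<close>. If \<open>f\<close> is not in the range of \<open>A\<close>, its component \<open>r\<close>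
  orthogonal to the range lies in the kernel of the symmetric matrix \<open>A\<close>, and along \<open>(1, s r)\<close>
  the form is the affine function \<open>c - 2 s (r \<bullet> r)\<close> of \<open>s\<close>, which is unbounded below.

  The pseudoinverse is introduced by a definite description, so it satisfies the Penrose equations
  only once a solution is known to exist and to be unique. Existence comes from the minimum-norm
  least-squares solution (\<open>min_norm_least_squares_ex1\<close>), uniqueness from matrix algebra.
\<close>

section \<open>The Moore-Penrose pseudoinverse\<close>

(* Products with a transpose are kept as they are instead of being turned into row-vector products,
   so that the facts about *v apply to them. *)
declare transpose_matrix_vector [simp del]

lemma subspace_range_matrix_vector_mult:
  fixes A :: "real^'n^'m"
  shows "subspace (range ((*v) A))"
  by (simp add: linear_subspace_image)

lemma inner_matrix_vector_transpose:
  fixes A :: "real^'n^'m"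
  shows "x \<bullet> (A *v y) = (transpose A *v x) \<bullet> y"
  by (metis dot_lmul_matrix vector_transpose_matrix transpose_transpose)

text \<open>Obtained by splitting a vector orthogonally along the range of \<open>A\<close>: the part orthogonal to
  the range is annihilated by the transpose.\<close>

lemma range_plus_transpose_kernel:
  fixes A :: "real^'n^'m"
  obtains w r where "y = A *v w + r" "transpose A *v r = 0"
proof -
  obtain u r where u: "u \<in> span (range ((*v) A))"
    and r: "\<And>w. w \<in> span (range ((*v) A)) \<Longrightarrow> orthogonal r w" and y: "y = u + r"
    using orthogonal_subspace_decomp_exists by blast
  obtain w where w: "u = A *v w"
    using u by (auto simp: span_eq_iff[THEN iffD2, OF subspace_range_matrix_vector_mult])
  have "(transpose A *v r) \<bullet> v = 0" for v
    using r[of "A *v v"] by (simp add: span_base orthogonal_def inner_matrix_vector_transpose)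
  from this[of "transpose A *v r"] have "transpose A *v r = 0"
    by simp
  with y w show thesis
    by (intro that) simp_all
qed

text \<open>The row space is orthogonal to the kernel, so the two meet only in \<open>0\<close>.\<close>

lemma range_transpose_eq_0:
  fixes A :: "real^'n^'m"
  assumes "z \<in> range ((*v) (transpose A))" "A *v z = 0"
  shows "z = 0"
proof -
  obtain u where u: "z = transpose A *v u"
    using assms by blast
  have "z \<bullet> z = u \<bullet> (A *v z)"
    by (simp add: inner_matrix_vector_transpose u)
  then show ?thesis
    using assms by simp
qed

text \<open>This cancels the factor \<open>A\<^sup>T\<close> from the normal equations: \<open>A z\<close> is in the row space of
  \<open>A\<^sup>T\<close> and in its kernel.\<close>

lemma transpose_kernel_normal_equation:
  fixes A :: "real^'n^'m"
  assumes "transpose A *v (A *v z) = 0"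
  shows "A *v z = 0"
  using range_transpose_eq_0[of "A *v z" "transpose A"] assms by simp

text \<open>The normal equation \<open>A\<^sup>T A z = A\<^sup>T y\<close> says that \<open>z\<close> is a least-squares solution of \<open>A z = y\<close>;
  membership in the range of \<open>A\<^sup>T\<close>, the orthogonal complement of the kernel, selects the shortest
  one. This vector depends linearly on \<open>y\<close>, and the pseudoinverse is the matrix of that map.\<close>

lemma min_norm_least_squares_ex1:
  fixes A :: "real^'n^'m"
  shows "\<exists>!z. z \<in> range ((*v) (transpose A)) \<and> transpose A *v (A *v z) = transpose A *v y"
proof (rule ex_ex1I)
  obtain w r where y: "y = A *v w + r" "transpose A *v r = 0"
    by (rule range_plus_transpose_kernel)
  obtain u s where w: "w = transpose A *v u + s" "A *v s = 0"
    using range_plus_transpose_kernel[of w "transpose A"] by (metis transpose_transpose)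
  have "transpose A *v (A *v (transpose A *v u)) = transpose A *v y"
    using y w by (simp add: matrix_vector_right_distrib)
  then show "\<exists>z. z \<in> range ((*v) (transpose A)) \<and> transpose A *v (A *v z) = transpose A *v y"
    by blast
next
  fix z z'
  assume z: "z \<in> range ((*v) (transpose A)) \<and> transpose A *v (A *v z) = transpose A *v y"
    and z': "z' \<in> range ((*v) (transpose A)) \<and> transpose A *v (A *v z') = transpose A *v y"
  have "transpose A *v (A *v (z - z')) = 0"
    using z z' by (simp add: matrix_vector_mult_diff_distrib)
  then have "A *v (z - z') = 0"
    by (rule transpose_kernel_normal_equation)
  moreover have "z - z' \<in> range ((*v) (transpose A))"
    using z z' subspace_diff[OF subspace_range_matrix_vector_mult] by blast
  ultimately show "z = z'"
    using range_transpose_eq_0 by fastforce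
qed

lemma symmetric_matrixI:
  fixes P :: "real^'n^'n"
  assumes "\<And>x y. x \<bullet> (P *v y) = (P *v x) \<bullet> y"
  shows "transpose P = P"
proof -
  have "(transpose P *v x - P *v x) \<bullet> y = 0" for x y
    using assms[of x y] by (simp add: inner_diff_left inner_matrix_vector_transpose)
  then have "transpose P *v x = P *v x" for x
    using inner_eq_zero_iff[of "transpose P *v x - P *v x"] by simp
  then show ?thesis
    by (simp add: matrix_eq)
qed

lemma pseudoinverse_exists:
  fixes A :: "real^'n^'m"
  shows "\<exists>X. is_pseudoinverse A X"
proof -
  define sol where "sol y z \<longleftrightarrow>
    z \<in> range ((*v) (transpose A)) \<and> transpose A *v (A *v z) = transpose A *v y" for y z
  obtain g where g: "\<And>y. sol y (g y)"
    using min_norm_least_squares_ex1[of A] unfolding sol_def by metis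
  have g_eq: "g y = z" if "sol y z" for y z
    using that g[of y] min_norm_least_squares_ex1[of A y] unfolding sol_def by blast
  have "linear g"
  proof (rule linearI)
    fix x y and c :: real
    show "g (x + y) = g x + g y"
    proof (rule g_eq)
      show "sol (x + y) (g x + g y)"
        using g[of x] g[of y] unfolding sol_def
        by (intro conjI subspace_add[OF subspace_range_matrix_vector_mult])
          (simp_all add: matrix_vector_right_distrib)
    qed
    show "g (c *\<^sub>R x) = c *\<^sub>R g x"
    proof (rule g_eq)
      show "sol (c *\<^sub>R x) (c *\<^sub>R g x)"
        using g[of x] unfolding sol_def
        by (intro conjI subspace_scale[OF subspace_range_matrix_vector_mult])
          (simp_all add: matrix_vector_mult_scaleR)
    qed
  qed
  define X where "X = matrix g"
  have X: "X *v y = g y" for y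
    using \<open>linear g\<close> by (simp add: X_def matrix_works)
  have residual: "(y - A *v (X *v y)) \<bullet> (A *v v) = 0" for y v
    using g[of y]
    by (simp add: sol_def X inner_matrix_vector_transpose matrix_vector_mult_diff_distrib)
  have AXA: "A *v (X *v (A *v x)) = A *v x" for x
    using transpose_kernel_normal_equation[of A "X *v (A *v x) - x"] g[of "A *v x"]
    by (simp add: sol_def X matrix_vector_mult_diff_distrib)
  have XAX: "X *v (A *v (X *v y)) = X *v y" for y
    using g_eq[of "A *v (X *v y)" "X *v y"] g[of y] by (simp add: sol_def X)
  have row_residual: "(x - X *v (A *v x)) \<bullet> (X *v y) = 0" for x y
  proof -
    obtain u where u: "X *v y = transpose A *v u"
      using g[of y] by (auto simp: sol_def X)
    have "A *v (x - X *v (A *v x)) = 0"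
      by (simp add: matrix_vector_mult_diff_distrib AXA)
    then show ?thesis
      by (simp add: u inner_matrix_vector_transpose)
  qed
  have "is_pseudoinverse A X"
    unfolding is_pseudoinverse_def
  proof (intro conjI)
    show "A ** X ** A = A"
      by (simp add: matrix_eq AXA flip: matrix_vector_mul_assoc)
    show "X ** A ** X = X"
      by (simp add: matrix_eq XAX flip: matrix_vector_mul_assoc)
    \<comment> \<open>The map \<open>A X\<close> is symmetric because \<open>y - A X y\<close> is orthogonal to its image; likewise \<open>X A\<close>.\<close>
    show "transpose (A ** X) = A ** X"
    proof (rule symmetric_matrixI)
      fix x y
      show "x \<bullet> (A ** X *v y) = (A ** X *v x) \<bullet> y"
        using residual[of x "X *v y"] residual[of y "X *v x"]
        by (simp add: inner_diff_left inner_diff_right inner_commute flip: matrix_vector_mul_assoc)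
    qed
    show "transpose (X ** A) = X ** A"
    proof (rule symmetric_matrixI)
      fix x y
      show "x \<bullet> (X ** A *v y) = (X ** A *v x) \<bullet> y"
        using row_residual[of x "A *v y"] row_residual[of y "A *v x"]
        by (simp add: inner_diff_left inner_diff_right inner_commute flip: matrix_vector_mul_assoc)
    qed
  qed
  then show ?thesis
    by blast
qed

lemma pseudoinverse_mult_right_eq:
  fixes A :: "real^'n^'m"
  assumes "is_pseudoinverse A X" "is_pseudoinverse A Y"
  shows "A ** X = A ** Y"
proof -
  have "A ** X = transpose ((A ** Y) ** (A ** X))"
    using assms by (metis is_pseudoinverse_def matrix_mul_assoc)
  also have "\<dots> = (A ** X) ** (A ** Y)"
    using assms by (metis is_pseudoinverse_def matrix_transpose_mul)
  also have "\<dots> = A ** Y"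
    using assms by (metis is_pseudoinverse_def matrix_mul_assoc)
  finally show ?thesis .
qed

lemma is_pseudoinverse_transpose:
  "is_pseudoinverse A X \<Longrightarrow> is_pseudoinverse (transpose A) (transpose X)"
  unfolding is_pseudoinverse_def matrix_transpose_mul[symmetric] matrix_mul_assoc by simp

text \<open>Any two pseudoinverses have the same products \<open>A X\<close> and \<open>X A\<close>, the second by transposition
  of the first, and \<open>X = X A X\<close> is built from these two products.\<close>

lemma pseudoinverse_unique:
  fixes A :: "real^'n^'m"
  assumes "is_pseudoinverse A X" "is_pseudoinverse A Y"
  shows "X = Y"
proof -
  have right: "A ** X = A ** Y"
    using assms by (rule pseudoinverse_mult_right_eq)
  have "transpose A ** transpose X = transpose A ** transpose Y"
    using assms by (intro pseudoinverse_mult_right_eq is_pseudoinverse_transpose)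
  then have left: "X ** A = Y ** A"
    by (metis matrix_transpose_mul transpose_transpose)
  have "X = X ** (A ** X)"
    using assms by (simp add: is_pseudoinverse_def matrix_mul_assoc)
  also have "\<dots> = (Y ** A) ** Y"
    by (simp add: right left matrix_mul_assoc)
  also have "\<dots> = Y"
    using assms by (simp add: is_pseudoinverse_def)
  finally show ?thesis .
qed

lemma is_pseudoinverse_pseudoinverse:
  fixes A :: "real^'n^'m"
  shows "is_pseudoinverse A (pseudoinverse A)"
  unfolding pseudoinverse_def
  using pseudoinverse_exists[of A] by (auto intro: theI2 dest: pseudoinverse_unique)

lemma inner_pseudoinverse_of_range:
  fixes A :: "real^'n^'n"
  assumes "transpose A = A"
  shows "(A *v w) \<bullet> (pseudoinverse A *v (A *v w)) = w \<bullet> (A *v w)"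
proof -
  have "A *v (pseudoinverse A *v (A *v w)) = A *v w"
    using is_pseudoinverse_pseudoinverse[of A]
    by (simp add: is_pseudoinverse_def matrix_vector_mul_assoc matrix_mul_assoc)
  then show ?thesis
    using assms inner_matrix_vector_transpose[of w A "pseudoinverse A *v (A *v w)"] by simp
qed

section \<open>Quadratic forms of block matrices\<close>

definition block_vector :: "'a^'m \<Rightarrow> 'a^'n \<Rightarrow> 'a^('m + 'n)" where
  "block_vector u v = (\<chi> i. case i of Inl j \<Rightarrow> u $ j | Inr j \<Rightarrow> v $ j)"

lemma block_vector_cases:
  obtains u v where "x = block_vector u v"
proof
  show "x = block_vector (\<chi> i. x $ Inl i) (\<chi> i. x $ Inr i)"
    by (simp add: block_vector_def vec_eq_iff split: sum.split)
qed

lemma sum_UNIV_Plus: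
  fixes h :: "'m::finite + 'n::finite \<Rightarrow> 'a::comm_monoid_add"
  shows "sum h UNIV = (\<Sum>i\<in>UNIV. h (Inl i)) + (\<Sum>i\<in>UNIV. h (Inr i))"
  by (simp add: sum.Plus flip: UNIV_Plus_UNIV)

lemma inner_block_vector:
  fixes u u' :: "real^'m" and v v' :: "real^'n"
  shows "block_vector u v \<bullet> block_vector u' v' = u \<bullet> u' + v \<bullet> v'"
  by (simp add: inner_vec_def sum_UNIV_Plus block_vector_def)

lemma block_matrix_vector_mult:
  fixes A :: "real^'n^'m"
  shows "block_matrix A B C D *v block_vector u v = block_vector (A *v u + B *v v) (C *v u + D *v v)"
  by (simp add: vec_eq_iff matrix_vector_mult_def sum_UNIV_Plus block_vector_def block_matrix_def
      split: sum.split)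

lemma block_matrix_eq_iff:
  "block_matrix A B C D = block_matrix A' B' C' D' \<longleftrightarrow> A = A' \<and> B = B' \<and> C = C' \<and> D = D'"
  by (auto simp: vec_eq_iff block_matrix_def split_sum_all)

lemma transpose_block_matrix:
  "transpose (block_matrix A B C D) =
     block_matrix (transpose A) (transpose C) (transpose B) (transpose D)"
  by (simp add: vec_eq_iff transpose_def block_matrix_def split_sum_all)

lemma symmetric_block_matrix_iff:
  "transpose (block_matrix A B C D) = block_matrix A B C D \<longleftrightarrow>
     transpose A = A \<and> C = transpose B \<and> transpose D = D"
  by (auto simp: transpose_block_matrix block_matrix_eq_iff)

lemma psd_block_matrix_iff:
  fixes A :: "real^'m^'m" and D :: "real^'n^'n"
  shows "psd (block_matrix A B C D) \<longleftrightarrow>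
     transpose A = A \<and> C = transpose B \<and> transpose D = D \<and>
     (\<forall>u v. 0 \<le> u \<bullet> (A *v u) + 2 * (u \<bullet> (B *v v)) + v \<bullet> (D *v v))"
proof -
  have form: "C = transpose B \<Longrightarrow> block_vector u v \<bullet> (block_matrix A B C D *v block_vector u v) =
      u \<bullet> (A *v u) + 2 * (u \<bullet> (B *v v)) + v \<bullet> (D *v v)" for u v
    using inner_matrix_vector_transpose[of u B v]
    by (simp add: block_matrix_vector_mult inner_block_vector inner_add_right inner_commute)
  have all: "(\<forall>x :: real^('m + 'n). P x) \<longleftrightarrow> (\<forall>u v. P (block_vector u v))" for P
    by (metis block_vector_cases)
  show ?thesis
    unfolding psd_def symmetric_block_matrix_iff all using form by auto
qed

lemma psd_bordered_iff_quadratic: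
  fixes A :: "real^'n^'n" and f :: "real^'n"
  shows "psd (block_matrix (mat c :: real^1^1) (- rowvector f) (- columnvector f) A) \<longleftrightarrow>
     transpose A = A \<and> (\<forall>t v. 0 \<le> c * t\<^sup>2 - 2 * t * (f \<bullet> v) + v \<bullet> (A *v v))"
proof -
  have form: "u \<bullet> ((mat c :: real^1^1) *v u) + 2 * (u \<bullet> (- rowvector f *v v)) =
      c * (u $ 1)\<^sup>2 - 2 * u $ 1 * (f \<bullet> v)" for u :: "real^1" and v :: "real^'n"
    by (simp add: inner_vec_def matrix_vector_mult_def mat_def rowvector_def power2_eq_square
        sum_negf)
  have border: "- columnvector f = transpose (- rowvector f)"
    by (simp add: vec_eq_iff transpose_def columnvector_def rowvector_def)
  have all: "(\<forall>u :: real^1. P (u $ 1)) \<longleftrightarrow> (\<forall>t. P t)" for P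
    by (metis vec_component)
  show ?thesis
    unfolding psd_block_matrix_iff form
    by (simp add: border transpose_mat
        all[of "\<lambda>t. \<forall>v. 0 \<le> c * t\<^sup>2 - 2 * t * (f \<bullet> v) + v \<bullet> (A *v v)"])
qed

section \<open>The Schur complement criterion\<close>

lemma complete_square_bordered:
  fixes A :: "real^'n^'n"
  assumes "transpose A = A"
  shows "c * t\<^sup>2 - 2 * t * ((A *v w) \<bullet> v) + v \<bullet> (A *v v) =
    (v - t *\<^sub>R w) \<bullet> (A *v (v - t *\<^sub>R w)) + t\<^sup>2 * (c - w \<bullet> (A *v w))"
proof -
  have "w \<bullet> (A *v v) = (A *v w) \<bullet> v"
    using assms inner_matrix_vector_transpose[of w A v] by simp
  then show ?thesis
    by (simp add: matrix_vector_mult_diff_distrib matrix_vector_mult_scaleR inner_diff_left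
        inner_diff_right inner_commute power2_eq_square algebra_simps)
qed

lemma psd_bordered_iff:
  fixes A :: "real^'n^'n" and f :: "real^'n"
  shows "psd (block_matrix (mat c :: real^1^1) (- rowvector f) (- columnvector f) A) \<longleftrightarrow>
     psd A \<and> f \<in> range ((*v) A) \<and> f \<bullet> (pseudoinverse A *v f) \<le> c"
    (is "?L \<longleftrightarrow> ?R")
proof
  assume ?L
  then have sym: "transpose A = A"
    and form: "\<And>t v. 0 \<le> c * t\<^sup>2 - 2 * t * (f \<bullet> v) + v \<bullet> (A *v v)"
    by (auto simp: psd_bordered_iff_quadratic)
  have "psd A"
    using sym form[of 0] by (simp add: psd_def)
  obtain w r where f: "f = A *v w + r" "A *v r = 0"
    using range_plus_transpose_kernel[of f A] sym by metis
  have "(A *v w) \<bullet> r = w \<bullet> (A *v r)"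
    using sym inner_matrix_vector_transpose[of w A r] by simp
  then have "f \<bullet> r = r \<bullet> r"
    using f by (simp add: inner_add_left)
  then have line: "0 \<le> c - 2 * s * (r \<bullet> r)" for s
    using form[of 1 "s *\<^sub>R r"] f by (simp add: matrix_vector_mult_scaleR)
  have "r = 0"
  proof (rule ccontr)
    assume "r \<noteq> 0"
    \<comment> \<open>At this parameter the affine function takes the value \<open>- 1\<close>.\<close>
    then show False
      using line[of "(c + 1) / (2 * (r \<bullet> r))"] by simp
  qed
  then have fw: "f = A *v w"
    using f by simp
  have "w \<bullet> (A *v w) \<le> c"
    using form[of 1 w] complete_square_bordered[OF sym, of c 1 w w] by (simp add: fw)
  then show ?R
    using \<open>psd A\<close> fw inner_pseudoinverse_of_range[OF sym] by auto
next
  assume ?R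
  then have sym: "transpose A = A" and nonneg: "\<And>x. 0 \<le> x \<bullet> (A *v x)"
    by (auto simp: psd_def)
  obtain w where w: "f = A *v w"
    using \<open>?R\<close> by blast
  have "w \<bullet> (A *v w) \<le> c"
    using \<open>?R\<close> inner_pseudoinverse_of_range[OF sym, of w] by (simp add: w)
  then have "0 \<le> c * t\<^sup>2 - 2 * t * (f \<bullet> v) + v \<bullet> (A *v v)" for t v
    unfolding w complete_square_bordered[OF sym] by (intro add_nonneg_nonneg nonneg) simp
  then show ?L
    using sym by (simp add: psd_bordered_iff_quadratic)
qed

theorem proposition2:
  fixes K1 K2 K3 M1 :: "'e::finite \<Rightarrow> real^'n^'n"
    and M0 :: "real^'n^'n"
    and a :: "real^'e"
    and \<omega> p :: real
    and f :: "real^'n"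
  assumes "\<And>e. psd (K1 e)" and "\<And>e. psd (K2 e)" and "\<And>e. psd (K3 e)"
    and "psd M0" and "\<And>e. psd (M1 e)"
    and "\<And>e. 0 \<le> a $ e"
    and "\<omega> > 0" and "p > 0"
  shows "(psd (stiffness K1 K2 K3 a - \<omega>\<^sup>2 *\<^sub>R mass M0 M1 a)
          \<and> f \<in> range ((*v) (stiffness K1 K2 K3 a - \<omega>\<^sup>2 *\<^sub>R mass M0 M1 a))
          \<and> 1 / 2 * \<omega> * (f \<bullet> (pseudoinverse (stiffness K1 K2 K3 a - \<omega>\<^sup>2 *\<^sub>R mass M0 M1 a) *v f)) \<le> p)
     \<longleftrightarrow> psd (block_matrix (mat (2 * p / \<omega>) :: real^1^1) (- rowvector f)
                (- columnvector f) (stiffness K1 K2 K3 a - \<omega>\<^sup>2 *\<^sub>R mass M0 M1 a))"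
proof -
  have "1 / 2 * \<omega> * q \<le> p \<longleftrightarrow> q \<le> 2 * p / \<omega>" for q
    using \<open>\<omega> > 0\<close> by (simp add: field_simps)
  then show ?thesis
    by (simp add: psd_bordered_iff)
qed

end
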